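(* Let $n\ge 2$ and $0\le k<n$ be integers. Let $(X,\|\cdot\|X)$ be any moment rearrangement invariant (m.r.i.) space relative to an auxiliary norm $\langle\cdot\rangle$, and let $(Y,\|\cdot\|Y)$ be another m.r.i. space over the same set $T=(a,b)$ with Lebesgue measure $m$, relative to a second auxiliary norm $\langle\langle\cdot\rangle\rangle$. Then the pair $(X,Y)$ is a (strong) Wirtinger's pair, uniformly in $\Delta=b-a\in(0,\infty)$: $$\sup_{\Delta>0}W_{n,k}(X,Y;\Delta)\le A(n,k)<\infty .$$
   Context: Let $T=(a,b)$ be a bounded interval with Lebesgue measure $m$ and $\Delta=b-a\in(0,\infty)$ (one may take $(a,b)=(0,\Delta)$). For measurable $f:(a,b)\to\mathbb{R}$ and $1\le p<\infty$ put $|f|_p=\left(\int_a^b|f(x)|^p\,dx\right)^{1/p}$. **The class $Z(n,k)$.** $Z(n,k)$ is the set of functions $f$ on $[a,b]$ having a generalized derivative $f^{(n)}$ of order $n$ and such that $f^{(i)}(a)=0$ for $i=0,\dots,k-1$ and $f^{(j)}(b)=0$ for $j=0,\dots,n-k-1$ (a $k$-fold zero at $a$ and an $(n-k)$-fold zero at $b$). **The constant $A(n,k)$.** $A(n,k)$ is the least constant such that for all $p,q\in(1,\infty)$, all bounded intervals $(a,b)$ with $\Delta=b-a$, and all $f\in Z(n,k)$ with $f^{(n)}\in L_q$, $$|f|_p\le A(n,k)\,\Delta^{\,n+1/p-1/q}\,|f^{(n)}|_q ,$$ i.e. $A(n,k)$ is the supremum of $|f|_p/(\Delta^{n+1/p-1/q}|f^{(n)}|_q)$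 over all such $p,q,\Delta,f$ with $f^{(n)}\ne0$. It is a known result (Brink) that $A(n,k)<\infty$. **m.r.i. spaces.** A rearrangement invariant (r.i.) space $(X,\|\cdot\|X)$ of measurable functions $T\to\mathbb{R}$ is a moment rearrangement invariant (m.r.i.) space if there are real constants $A,B$ with $1\le A<B\le\infty$ and a rearrangement invariant norm $\langle\cdot\rangle$ (in the usual sense, in particular monotone in $|h|$), defined on the space of real functions on the interval $(A,B)$ and not necessarily finite on all functions, such that for all $f\in X$ $$\|f\|X=\langle h(\cdot)\rangle,\qquad h(p)=|f|_p,\ p\in(A,B).$$ The constants $A,B$ and the auxiliary norm may be different for $X$ and $Y$. The auxiliary norms are fixed, and as $\Delta$ varies, $X$ and $Y$ denote the corresponding spaces over the interval of length $\Delta$ defined by these same auxiliary norms. **Fundamental function.** $\phi(X,\delta)=\sup\{\|I(A)\|X:\ A\text{ measurable},\ m(A)\le\delta\}$, where $I(A)$ is the indicator function of $A$. For an m.r.i. space $(X,\|\cdot\|X)$ with constants $A,B$ and auxiliary norm $\langle\cdot\rangle$ (that is, with $\|f\|X=\langle h(\cdot)\rangle$, $h(p)=|f|_p$, $p\in(A,B)$, for all $f\in X$), $\phi(X,\delta)=\langle f(\cdot)\rangle$ with $f(p)=\delta^{1/p}$, $p\in(A,B)$. **Wirtinger functional.** $$W_{n,k}(X,Y;\Delta)=\sup_{f\in Z(n,k),\ f^{(n)}\ne0}\left[\frac{\|f\|X}{\phi(X,\Delta)}:\frac{\Delta^n\,\|f^{(n)}\|Y}{\phi(Y,\Delta)}\right],$$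 where $u:v$ denotes the quotient $u/v$ (the quotient being $0$ when $\|f^{(n)}\|Y=\infty$). The pair $(X,Y)$ is called a (strong) Wirtinger's pair if $\sup_{\Delta\in(0,\infty)}W_{n,k}(X,Y;\Delta)<\infty$. *)

theory Defs
  imports "HOL-Analysis.Analysis"
begin

section \<open>Rearrangement invariant norms\<close>

text \<open>Norms of function spaces are given as functionals \<open>\<rho>\<close> on the measurable functions with values
  in \<open>[0,\<infinity>]\<close> (Bennett and Sharpley); the norm of a real function \<open>f\<close> is \<open>\<rho> \<bar>f\<bar>\<close>, possibly \<open>\<infinity>\<close>, and
  the space consists of the \<open>f\<close> for which it is finite. Values of \<open>\<rho>\<close> on nonmeasurable functions are
  irrelevant.\<close>

definition equimeasurable :: "'a measure \<Rightarrow> ('a \<Rightarrow> ennreal) \<Rightarrow> ('a \<Rightarrow> ennreal) \<Rightarrow> bool" where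
  "equimeasurable M f g \<longleftrightarrow>
     (\<forall>t. emeasure M {x \<in> space M. f x > t} = emeasure M {x \<in> space M. g x > t})"

locale ri_norm =
  fixes M :: "'a measure" and \<rho> :: "('a \<Rightarrow> ennreal) \<Rightarrow> ennreal"
  assumes eq_0_iff: "f \<in> borel_measurable M \<Longrightarrow> \<rho> f = 0 \<longleftrightarrow> (AE x in M. f x = 0)"
    and scale: "f \<in> borel_measurable M \<Longrightarrow> c \<ge> 0 \<Longrightarrow> \<rho> (\<lambda>x. ennreal c * f x) = ennreal c * \<rho> f"
    and triangle: "f \<in> borel_measurable M \<Longrightarrow> g \<in> borel_measurable M \<Longrightarrow>
          \<rho> (\<lambda>x. f x + g x) \<le> \<rho> f + \<rho> g"
    and mono: "f \<in> borel_measurable M \<Longrightarrow> g \<in> borel_measurable M \<Longrightarrow>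
          (AE x in M. g x \<le> f x) \<Longrightarrow> \<rho> g \<le> \<rho> f"
    and rearrange: "f \<in> borel_measurable M \<Longrightarrow> g \<in> borel_measurable M \<Longrightarrow>
          (AE x in M. f x < \<infinity>) \<Longrightarrow> (AE x in M. g x < \<infinity>) \<Longrightarrow>
          equimeasurable M f g \<Longrightarrow> \<rho> f = \<rho> g"

text \<open>The remaining axioms of a Banach function norm; they make the space of functions of finite norm
  a Banach space between \<open>L\<^sub>\<infinity>\<close> and \<open>L\<^sub>1\<close> when \<open>M\<close> is finite.\<close>

locale ri_space = ri_norm +
  assumes Fatou: "(\<And>i. f i \<in> borel_measurable M) \<Longrightarrow>
          (AE x in M. incseq (\<lambda>i::nat. f i x)) \<Longrightarrow> \<rho> (\<lambda>x. SUP i. f i x) = (SUP i. \<rho> (f i))"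
    and indicator_finite: "E \<in> sets M \<Longrightarrow> emeasure M E < \<infinity> \<Longrightarrow> \<rho> (indicator E) < \<infinity>"
    and locally_L1: "E \<in> sets M \<Longrightarrow> emeasure M E < \<infinity> \<Longrightarrow>
          \<exists>C<\<infinity>. \<forall>f\<in>borel_measurable M. (\<integral>\<^sup>+x\<in>E. f x \<partial>M) \<le> C * \<rho> f"
begin

definition carrier :: "('a \<Rightarrow> real) set" where
  "carrier = {f \<in> borel_measurable M. \<rho> (\<lambda>x. ennreal \<bar>f x\<bar>) < \<infinity>}"

end


section \<open>Moment rearrangement invariant spaces\<close>

definition lp_norm :: "real \<Rightarrow> real \<Rightarrow> real \<Rightarrow> (real \<Rightarrow> real) \<Rightarrow> ennreal" where
  "lp_norm a b p f =
     (let I = \<integral>\<^sup>+x. ennreal (\<bar>f x\<bar> powr p) \<partial>lebesgue_on {a<..<b}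
      in if I = \<infinity> then \<infinity> else ennreal (enn2real I powr (1 / p)))"

text \<open>For an auxiliary norm \<open>N\<close> on functions on an interval \<open>(A,B)\<close>, this is the norm it defines over
  \<open>(a,b)\<close>: the value of \<open>N\<close> at \<open>h(p) = \<bar>f\<bar>\<^sub>p\<close>. By \<open>ri_norm.mono\<close> only the \<open>p \<in> (A,B)\<close> matter.\<close>

definition mri_norm ::
  "((real \<Rightarrow> ennreal) \<Rightarrow> ennreal) \<Rightarrow> real \<Rightarrow> real \<Rightarrow> (real \<Rightarrow> real) \<Rightarrow> ennreal" where
  "mri_norm N a b f = N (\<lambda>p. lp_norm a b p f)"

locale mri_space =
  ri_space "lebesgue_on {a<..<b}" \<rho> + aux: ri_norm "lebesgue_on {p. A < p \<and> ereal p < B}" N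
  for a b :: real and \<rho> :: "(real \<Rightarrow> ennreal) \<Rightarrow> ennreal"
    and A :: real and B :: ereal and N :: "(real \<Rightarrow> ennreal) \<Rightarrow> ennreal" +
  assumes bounds: "1 \<le> A" "ereal A < B"
    and norm_eq: "f \<in> carrier \<Longrightarrow> \<rho> (\<lambda>x. ennreal \<bar>f x\<bar>) = mri_norm N a b f"

text \<open>From here on \<open>X\<close> and \<open>Y\<close> assign to each interval \<open>(a,b)\<close> a norm on real functions over it.\<close>

definition fundamental_function ::
  "(real \<Rightarrow> real \<Rightarrow> (real \<Rightarrow> real) \<Rightarrow> ennreal) \<Rightarrow> real \<Rightarrow> real \<Rightarrow> real \<Rightarrow> ennreal" where
  "fundamental_function X a b \<delta> =
     (SUP E \<in> {E \<in> sets lebesgue. E \<subseteq> {a<..<b} \<and> emeasure lebesgue E \<le> ennreal \<delta>}.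
        X a b (indicat_real E))"


section \<open>The Wirtinger functional\<close>

text \<open>\<open>D i\<close> is the derivative of order \<open>i\<close> of \<open>f\<close> on \<open>[a,b]\<close>: classical for \<open>i < n\<close>, and for \<open>i = n\<close>
  generalized, i.e. \<open>D (n - 1)\<close> is an indefinite Lebesgue integral of \<open>D n\<close> (so it is absolutely
  continuous). Meaningful for \<open>n \<ge> 1\<close>.\<close>

definition generalized_derivatives ::
  "real \<Rightarrow> real \<Rightarrow> nat \<Rightarrow> (real \<Rightarrow> real) \<Rightarrow> (nat \<Rightarrow> real \<Rightarrow> real) \<Rightarrow> bool" where
  "generalized_derivatives a b n f D \<longleftrightarrow>
     D 0 = f \<and>
     (\<forall>i. Suc i < n \<longrightarrow>
        (\<forall>x\<in>{a..b}. (D i has_real_derivative D (Suc i) x) (at x within {a..b}))) \<and>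
     set_integrable lebesgue {a..b} (D n) \<and>
     (\<forall>x\<in>{a..b}. D (n - 1) x = D (n - 1) a + (LINT t:{a..x}|lebesgue. D n t))"

text \<open>The class \<open>Z(n,k)\<close> on \<open>[a,b]\<close>, as the set of pairs \<open>(f, g)\<close> with \<open>g\<close> a version of \<open>f\<^sup>(\<^sup>n\<^sup>)\<close>,
  which is only determined almost everywhere.\<close>

definition Z :: "nat \<Rightarrow> nat \<Rightarrow> real \<Rightarrow> real \<Rightarrow> ((real \<Rightarrow> real) \<times> (real \<Rightarrow> real)) set" where
  "Z n k a b = {(f, g). \<exists>D. generalized_derivatives a b n f D \<and> D n = g \<and>
     (\<forall>i<k. D i a = 0) \<and> (\<forall>j<n - k. D j b = 0)}"

definition ae_zero :: "real \<Rightarrow> real \<Rightarrow> (real \<Rightarrow> real) \<Rightarrow> bool" where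
  "ae_zero a b g \<longleftrightarrow> (AE x in lebesgue_on {a<..<b}. g x = 0)"

definition A_const :: "nat \<Rightarrow> nat \<Rightarrow> ennreal" where
  "A_const n k = Sup {lp_norm a b p f /
       (ennreal ((b - a) powr (real n + 1 / p - 1 / q)) * lp_norm a b q g) | p q a b f g.
     1 < p \<and> 1 < q \<and> a < b \<and> (f, g) \<in> Z n k a b \<and> lp_norm a b q g < \<infinity> \<and> \<not> ae_zero a b g}"

text \<open>All intervals of length \<open>\<Delta>\<close> are admitted. In \<^typ>\<open>ennreal\<close> a quotient with denominator \<open>\<infinity>\<close>
  is \<open>0\<close>.\<close>

definition wirtinger_functional ::
  "nat \<Rightarrow> nat \<Rightarrow> (real \<Rightarrow> real \<Rightarrow> (real \<Rightarrow> real) \<Rightarrow> ennreal) \<Rightarrow>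
   (real \<Rightarrow> real \<Rightarrow> (real \<Rightarrow> real) \<Rightarrow> ennreal) \<Rightarrow> real \<Rightarrow> ennreal" where
  "wirtinger_functional n k X Y \<Delta> =
     Sup {(X a b f / fundamental_function X a b \<Delta>) /
          (ennreal (\<Delta> ^ n) * Y a b g / fundamental_function Y a b \<Delta>) | a b f g.
       b - a = \<Delta> \<and> (f, g) \<in> Z n k a b \<and> \<not> ae_zero a b g}"

definition wirtinger_pair ::
  "nat \<Rightarrow> nat \<Rightarrow> (real \<Rightarrow> real \<Rightarrow> (real \<Rightarrow> real) \<Rightarrow> ennreal) \<Rightarrow>
   (real \<Rightarrow> real \<Rightarrow> (real \<Rightarrow> real) \<Rightarrow> ennreal) \<Rightarrow> bool" where
  "wirtinger_pair n k X Y \<longleftrightarrow> (SUP \<Delta>\<in>{0<..}. wirtinger_functional n k X Y \<Delta>) < \<infinity>"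


section \<open>The auxiliary norm determines the space\<close>

text \<open>Over its own interval, an m.r.i. space is exactly the space defined by \<open>mri_norm\<close>: the norms
  also agree (and are infinite) off the carrier.\<close>

lemma lp_norm_mono:
  assumes "0 < p" "\<And>x. \<bar>f x\<bar> \<le> \<bar>g x\<bar>"
  shows "lp_norm a b p f \<le> lp_norm a b p g"
proof -
  have "(\<integral>\<^sup>+x. ennreal (\<bar>f x\<bar> powr p) \<partial>lebesgue_on {a<..<b})
      \<le> (\<integral>\<^sup>+x. ennreal (\<bar>g x\<bar> powr p) \<partial>lebesgue_on {a<..<b})"
    using assms by (intro nn_integral_mono ennreal_leI powr_mono2) auto
  then show ?thesis
    using assms(1)
    by (auto simp: lp_norm_def Let_def top_unique less_top intro!: ennreal_leI powr_mono2 enn2real_mono)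
qed

lemma borel_measurable_lp_norm:
  assumes f: "f \<in> borel_measurable (lebesgue_on {a<..<b})"
  shows "(\<lambda>p. lp_norm a b p f) \<in> borel_measurable borel"
proof -
  have "(\<lambda>x. if x \<in> {a<..<b} then f x else 0) \<in> borel_measurable lebesgue"
    using f by (subst borel_measurable_if) auto
  then obtain F where F[measurable]: "F \<in> borel_measurable lborel"
    and AE: "AE x in lborel. (if x \<in> {a<..<b} then f x else 0) = F x"
    using completion_ex_borel_measurable_real by blast
  have AE': "AE x in lebesgue. (if x \<in> {a<..<b} then f x else 0) = F x"
    using AE by (rule AE_completion)
  have [measurable]: "F \<in> borel_measurable borel" using F by simp
  let ?I = "\<lambda>p. \<integral>\<^sup>+x. ennreal (\<bar>F x\<bar> powr p) * indicator {a<..<b} x \<partial>lborel"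
  have I: "(\<integral>\<^sup>+x. ennreal (\<bar>f x\<bar> powr p) \<partial>lebesgue_on {a<..<b}) = ?I p" for p
  proof -
    have "(\<integral>\<^sup>+x. ennreal (\<bar>f x\<bar> powr p) \<partial>lebesgue_on {a<..<b})
        = (\<integral>\<^sup>+x. ennreal (\<bar>f x\<bar> powr p) * indicator {a<..<b} x \<partial>lebesgue)"
      by (rule nn_integral_restrict_space) simp
    also have "\<dots> = (\<integral>\<^sup>+x. ennreal (\<bar>F x\<bar> powr p) * indicator {a<..<b} x \<partial>lebesgue)"
      by (rule nn_integral_cong_AE, use AE' in eventually_elim) (auto simp: indicator_def)
    also have "\<dots> = ?I p"
      by (rule nn_integral_completion)
    finally show ?thesis .
  qed
  have [measurable]: "?I \<in> borel_measurable borel"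
    by (rule lborel.borel_measurable_nn_integral) measurable
  show ?thesis
    unfolding lp_norm_def I Let_def by measurable
qed

lemma (in mri_space) norm_eq_mri_norm:
  assumes f: "f \<in> borel_measurable (lebesgue_on {a<..<b})"
  shows "\<rho> (\<lambda>x. ennreal \<bar>f x\<bar>) = mri_norm N a b f"
proof (cases "f \<in> carrier")
  case True
  then show ?thesis by (rule norm_eq)
next
  case False
  then have inf: "\<rho> (\<lambda>x. ennreal \<bar>f x\<bar>) = \<infinity>"
    using f by (simp add: carrier_def not_less top_unique)
  define u where "u i x = min \<bar>f x\<bar> (real i)" for i x
  have um[measurable]: "u i \<in> borel_measurable (lebesgue_on {a<..<b})" for i
    unfolding u_def using f by measurable
  have h: "(\<lambda>p. lp_norm a b p g) \<in> borel_measurable (lebesgue_on {p. A < p \<and> ereal p < B})"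
    if "g \<in> borel_measurable (lebesgue_on {a<..<b})" for g
  proof -
    have "(\<lambda>p. lp_norm a b p g) \<in> borel_measurable lebesgue"
      using borel_measurable_lp_norm[OF that] by (intro measurable_completion) simp
    then show ?thesis by (rule measurable_restrict_space1)
  qed
  have "u i \<in> carrier" for i
  proof -
    have fin: "\<rho> (indicator {a<..<b}) < \<infinity>"
    proof (rule indicator_finite)
      show "{a<..<b} \<in> sets (lebesgue_on {a<..<b})"
        by (simp add: sets_restrict_space_iff)
      show "emeasure (lebesgue_on {a<..<b}) {a<..<b} < \<infinity>"
        by (cases "a \<le> b") (simp_all add: emeasure_restrict_space)
    qed
    have ind: "indicator {a<..<b} \<in> borel_measurable (lebesgue_on {a<..<b})"
      by (rule borel_measurable_indicator) (auto simp: sets_restrict_space)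
    have "\<rho> (\<lambda>x. ennreal \<bar>u i x\<bar>) \<le> \<rho> (\<lambda>x. ennreal (real i) * indicator {a<..<b} x)"
    proof (rule mono)
      show "(\<lambda>x. ennreal (real i) * indicator {a<..<b} x) \<in> borel_measurable (lebesgue_on {a<..<b})"
        using ind by measurable
      show "AE x in lebesgue_on {a<..<b}. ennreal \<bar>u i x\<bar> \<le> ennreal (real i) * indicator {a<..<b} x"
        by (rule AE_I2) (auto simp: u_def simp flip: ennreal_of_nat_eq_real_of_nat intro!: ennreal_leI)
    qed measurable
    also have "\<dots> = ennreal (real i) * \<rho> (indicator {a<..<b})"
      using ind by (intro scale) auto
    also have "\<dots> < \<infinity>"
      using fin by (simp add: ennreal_mult_less_top)
    finally show ?thesis by (simp add: carrier_def)
  qed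
  then have "\<rho> (\<lambda>x. ennreal \<bar>u i x\<bar>) = mri_norm N a b (u i)" for i
    by (rule norm_eq)
  also have "mri_norm N a b (u i) \<le> mri_norm N a b f" for i
    unfolding mri_norm_def
    by (rule aux.mono)
       (use bounds f in \<open>auto intro!: h um lp_norm_mono simp: u_def\<close>)
  finally have "(SUP i. \<rho> (\<lambda>x. ennreal \<bar>u i x\<bar>)) \<le> mri_norm N a b f"
    by (rule SUP_least)
  moreover have "(SUP i. \<rho> (\<lambda>x. ennreal \<bar>u i x\<bar>)) = \<rho> (\<lambda>x. SUP i. ennreal \<bar>u i x\<bar>)"
    by (rule Fatou[symmetric], measurable) (auto simp: u_def incseq_def intro!: ennreal_leI)
  moreover have "(SUP i. ennreal \<bar>u i x\<bar>) = ennreal \<bar>f x\<bar>" for x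
  proof (rule antisym)
    show "(SUP i. ennreal \<bar>u i x\<bar>) \<le> ennreal \<bar>f x\<bar>"
      by (intro SUP_least ennreal_leI) (auto simp: u_def)
    obtain i where "\<bar>f x\<bar> \<le> real i" using real_arch_simple by blast
    then have "ennreal \<bar>f x\<bar> = ennreal \<bar>u i x\<bar>" by (simp add: u_def min_def)
    also have "\<dots> \<le> (SUP i. ennreal \<bar>u i x\<bar>)" by (rule SUP_upper) simp
    finally show "ennreal \<bar>f x\<bar> \<le> (SUP i. ennreal \<bar>u i x\<bar>)" .
  qed
  ultimately show ?thesis using inf by (simp add: top_unique)
qed

end

theory Submission
  imports Defs
begin

text \<open>
  The Wirtinger quotient compares norms of moment functions \<open>p \<mapsto> \<bar>f\<bar>\<^sub>p\<close>, and for each pair of exponents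
  the moments of \<open>f\<close> and \<open>g = f\<^sup>(\<^sup>n\<^sup>)\<close> are compared by the definition of \<open>A(n,k)\<close>:
  \<open>\<bar>f\<bar>\<^sub>p \<le> (A(n,k) * \<Delta> powr (n - 1/q) * \<bar>g\<bar>\<^sub>q) * \<Delta> powr (1/p)\<close>.
  The right side separates the variables \<open>p\<close> and \<open>q\<close>. For fixed \<open>q\<close> with \<open>\<bar>g\<bar>\<^sub>q < \<infinity>\<close>, the norm of \<open>X\<close>
  applied in the variable \<open>p\<close> turns \<open>\<Delta> powr (1/p)\<close> into \<open>\<phi>(X,\<Delta>)\<close>, so that
  \<open>\<Delta> powr (1/q) * \<parallel>f\<parallel>\<^sub>X / \<phi>(X,\<Delta>) \<le> A(n,k) * \<Delta>\<^sup>n * \<bar>g\<bar>\<^sub>q\<close>.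
  The norm of \<open>Y\<close> applied in the variable \<open>q\<close> then turns the left side into a multiple of
  \<open>\<phi>(Y,\<Delta>)\<close> and gives the bound by \<open>A(n,k)\<close> (\<open>wirtinger_quotient_le_A_const\<close>). If \<open>\<bar>g\<bar>\<^sub>q\<close> is infinite
  for a nonnull set of \<open>q\<close>, homogeneity forces \<open>\<parallel>g\<parallel>\<^sub>Y = \<infinity>\<close> and the quotient is \<open>0\<close>. These divisions need
  \<open>0 < \<phi> < \<infinity>\<close> for every \<open>\<Delta>\<close>. Finiteness at the given \<open>b - a\<close> holds because indicators have
  finite norm in an r.i. space, and it passes to other \<open>\<Delta>\<close> because \<open>(\<Delta>/(b - a)) powr (1/p)\<close> is
  bounded for \<open>p \<ge> 1\<close>.

  Finiteness of \<open>A(n,k)\<close>, in fact \<open>A(n,k) \<le> 1\<close>, comes from counting zeros: the \<open>n\<close> boundary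
  conditions and Rolle's theorem give every derivative of order below \<open>n\<close> a zero in \<open>[a,b]\<close>
  (\<open>derivative_has_zero\<close>). Starting from these zeros, the mean value theorem bounds each derivative
  by \<open>\<Delta>\<close> times the supremum of the next one, whence \<open>\<bar>f\<bar> \<le> \<Delta>\<^sup>n\<^sup>-\<^sup>1 \<bar>g\<bar>\<^sub>1\<close>, and Hoelder's
  inequality finishes the estimate.
\<close>


section \<open>Zeros of the derivatives\<close>

text \<open>Rolle's theorem between consecutive zeros. The bound by \<open>Max S\<close> makes the induction on the
  number of zeros work: the new zero, found next to the largest element of \<open>S\<close>, lies to the right
  of all those found before.\<close>

lemma zeros_of_derivative:
  fixes f f' :: "real \<Rightarrow> real"
  assumes deriv: "\<And>x. x \<in> {a..b} \<Longrightarrow> (f has_real_derivative f' x) (at x within {a..b})"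
    and "finite S" "S \<subseteq> {a..b}" "\<And>x. x \<in> S \<Longrightarrow> f x = 0"
  shows "\<exists>T. finite T \<and> card T = card S - 1 \<and> T \<subseteq> {a<..<b} \<and> (\<forall>x\<in>T. x < Max S \<and> f' x = 0)"
  using assms(2-)
proof (induction "card S" arbitrary: S rule: less_induct)
  case (less S)
  show ?case
  proof (cases "card S \<le> 1")
    case True
    then show ?thesis by (intro exI[of _ "{}"]) auto
  next
    case False
    define R where "R = S - {Max S}"
    have "S \<noteq> {}" using False by auto
    then have max: "Max S \<in> S" using less.prems by simp
    have cardR: "card R = card S - 1" using max less.prems by (simp add: R_def)
    then have "R \<noteq> {}" using False by (metis One_nat_def card.empty diff_is_0_eq)
    moreover have "finite R" using less.prems by (simp add: R_def)
    ultimately have y: "Max R \<in> R" by simp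
    then have yS: "Max R \<in> S" "Max R \<noteq> Max S" by (auto simp: R_def)
    then have lt: "Max R < Max S" using less.prems by (simp add: order.not_eq_order_implies_strict)
    have "card R < card S" using cardR False by linarith
    then obtain T where T: "finite T" "card T = card R - 1" "T \<subseteq> {a<..<b}"
        "\<forall>x\<in>T. x < Max R \<and> f' x = 0"
      using less.hyps[of R] less.prems \<open>finite R\<close> by (auto simp: R_def)
    have sub: "{Max R..Max S} \<subseteq> {a..b}" using yS max less.prems by auto
    have "\<exists>z. Max R < z \<and> z < Max S \<and> (\<lambda>v. f' z * v) = (\<lambda>v. 0)"
    proof (rule Rolle_deriv[OF lt, where f = f])
      show "f (Max R) = f (Max S)" using yS max less.prems by simp
      have "continuous_on {a..b} f"
        using deriv by (rule DERIV_continuous_on)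
      then show "continuous_on {Max R..Max S} f" using sub continuous_on_subset by blast
    next
      fix x assume x: "Max R < x" "x < Max S"
      then have "x \<in> {a..b}" "a < x" "x < b"
        using yS(1) max less.prems(2) by (force simp: subset_iff)+
      then have "(f has_real_derivative f' x) (at x)"
        using deriv[of x] by (simp add: at_within_Icc_at)
      then show "(f has_derivative (\<lambda>v. f' x * v)) (at x)"
        by (simp add: has_field_derivative_def)
    qed
    then obtain z where z: "Max R < z" "z < Max S" "(\<lambda>v. f' z * v) = (\<lambda>v. 0)" by blast
    from fun_cong[OF z(3), of 1] have "f' z = 0" by simp
    moreover have "z \<notin> T" using T(4) z(1) by force
    moreover have "z \<in> {a<..<b}"
      using z yS(1) max less.prems(2) by (force simp: subset_iff)
    moreover have "card R \<ge> 1" using cardR False by linarith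
    ultimately show ?thesis
      using T z cardR lt by (intro exI[of _ "insert z T"]) auto
  qed
qed

text \<open>Passing from \<open>D i\<close> to \<open>D (i + 1)\<close> loses one zero, but the zeros that the boundary
  conditions give \<open>D i\<close> at \<open>a\<close> and \<open>b\<close> take part in Rolle's theorem, which moves them into the
  interior. Up to order \<open>i\<close> this happens \<open>min i k\<close> times at \<open>a\<close> and \<open>min i (n - k)\<close> times at \<open>b\<close>.\<close>

lemma interior_zeros:
  assumes D: "generalized_derivatives a b n f D" and "a < b" "k \<le> n"
    and za: "\<forall>i<k. D i a = 0" and zb: "\<forall>j<n - k. D j b = 0" and "i < n"
  shows "\<exists>T. finite T \<and> T \<subseteq> {a<..<b} \<and> (\<forall>x\<in>T. D i x = 0) \<and>
    min i k + min i (n - k) \<le> card T + i"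
  using \<open>i < n\<close>
proof (induction i)
  case 0
  then show ?case by (intro exI[of _ "{}"]) auto
next
  case (Suc i)
  then obtain T where T: "finite T" "T \<subseteq> {a<..<b}" "\<And>x. x \<in> T \<Longrightarrow> D i x = 0"
      "min i k + min i (n - k) \<le> card T + i"
    by auto
  define S where "S = T \<union> (if i < k then {a} else {}) \<union> (if i < n - k then {b} else {})"
  have S: "finite S" "S \<subseteq> {a..b}" "\<And>x. x \<in> S \<Longrightarrow> D i x = 0"
    using T za zb \<open>a < b\<close> by (auto simp: S_def split: if_splits)
  have "a \<notin> T" "b \<notin> T" using T(2) by auto
  then have card: "card S = card T + (if i < k then 1 else 0) + (if i < n - k then 1 else 0)"
    using T(1) \<open>a < b\<close> by (auto simp: S_def)
  have "(D i has_real_derivative D (Suc i) x) (at x within {a..b})" if "x \<in> {a..b}" for x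
    using D Suc.prems that unfolding generalized_derivatives_def by blast
  from zeros_of_derivative[OF this S] obtain U where
    "finite U" "card U = card S - 1" "U \<subseteq> {a<..<b}" "\<forall>x\<in>U. D (Suc i) x = 0" by blast
  moreover have "min (Suc i) k + min (Suc i) (n - k) \<le> card S - 1 + Suc i"
    using T(4) card \<open>k \<le> n\<close> Suc.prems by auto
  ultimately show ?case by (intro exI[of _ U]) auto
qed

text \<open>Once both supplies of boundary zeros are exhausted, \<open>interior_zeros\<close> leaves
  \<open>k + (n - k) - i = n - i > 0\<close> of them.\<close>

lemma derivative_has_zero:
  assumes D: "generalized_derivatives a b n f D" and "a < b" "k \<le> n"
    and za: "\<forall>i<k. D i a = 0" and zb: "\<forall>j<n - k. D j b = 0" and "i < n"
  shows "\<exists>z\<in>{a..b}. D i z = 0"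
proof -
  consider "i < k" | "i < n - k" | "k \<le> i" "n - k \<le> i" by linarith
  then show ?thesis
  proof cases
    case 3
    obtain T where T: "T \<subseteq> {a<..<b}" "\<forall>x\<in>T. D i x = 0" "min i k + min i (n - k) \<le> card T + i"
      using interior_zeros[OF assms] by blast
    have "card T > 0" using T(3) 3 \<open>k \<le> n\<close> \<open>i < n\<close> by simp
    then obtain x where "x \<in> T" by (metis card.empty ex_in_conv less_irrefl)
    then show ?thesis using T by (intro bexI[of _ x]) auto
  qed (use za zb \<open>a < b\<close> in auto)
qed

section \<open>The constant is finite\<close>

text \<open>Each derivative is bounded by integrating the next one from a zero: the generalized derivative
  \<open>D n\<close> in the first step, where the \<open>L\<^sub>1\<close> norm appears, and by the mean value theorem afterwards.\<close>

lemma derivative_bound: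
  assumes D: "generalized_derivatives a b n f D" and "a < b" "k \<le> n"
    and za: "\<forall>i<k. D i a = 0" and zb: "\<forall>j<n - k. D j b = 0"
    and "m < n" "x \<in> {a..b}"
  shows "\<bar>D (n - 1 - m) x\<bar> \<le> (b - a) ^ m * (LINT t:{a<..<b}|lebesgue. \<bar>D n t\<bar>)"
  using \<open>m < n\<close> \<open>x \<in> {a..b}\<close>
proof (induction m arbitrary: x)
  case 0
  obtain z where z: "z \<in> {a..b}" "D (n - 1) z = 0"
    using derivative_has_zero[OF D \<open>a < b\<close> \<open>k \<le> n\<close> za zb, of "n - 1"] 0 by auto
  have int: "set_integrable lebesgue {a..b} (D n)"
    using D unfolding generalized_derivatives_def by blast
  have FTC: "D (n - 1) y = D (n - 1) a + (LINT t:{a..y}|lebesgue. D n t)" if "y \<in> {a..b}" for y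
    using D that unfolding generalized_derivatives_def by blast
  have sub: "set_integrable lebesgue {a..y} (D n)" if "y \<in> {a..b}" for y
    using that by (intro set_integrable_subset[OF int]) auto
  \<comment> \<open>Both integrals start at \<open>a\<close>, so their difference is, up to sign, the integral
    over the interval between \<open>x\<close> and \<open>z\<close>.\<close>
  have "D (n - 1) x = (LINT t:{a..x}|lebesgue. D n t) - (LINT t:{a..z}|lebesgue. D n t)"
    using FTC[OF z(1)] FTC[OF 0(2)] z(2) by simp
  also have "\<dots> = (LINT t|lebesgue. indicator {a..x} t *\<^sub>R D n t - indicator {a..z} t *\<^sub>R D n t)"
    using sub[OF z(1)] sub[OF 0(2)]
    unfolding set_lebesgue_integral_def set_integrable_def
    by (rule Bochner_Integration.integral_diff[symmetric, rotated])
  also have "\<bar>\<dots>\<bar> \<le> (LINT t|lebesgue.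
      \<bar>indicator {a..x} t *\<^sub>R D n t - indicator {a..z} t *\<^sub>R D n t\<bar>)"
    by (rule integral_abs_bound)
  also have "\<dots> \<le> (LINT t|lebesgue. indicator {a<..<b} t *\<^sub>R \<bar>D n t\<bar>)"
  proof (rule integral_mono_AE)
    show "integrable lebesgue (\<lambda>t. \<bar>indicator {a..x} t *\<^sub>R D n t - indicator {a..z} t *\<^sub>R D n t\<bar>)"
      using sub[OF z(1)] sub[OF 0(2)]
      by (intro integrable_abs Bochner_Integration.integrable_diff) (auto simp: set_integrable_def)
    have "set_integrable lebesgue {a<..<b} (D n)"
      by (intro set_integrable_subset[OF int]) auto
    from set_integrable_abs[OF this]
    show "integrable lebesgue (\<lambda>t. indicator {a<..<b} t *\<^sub>R \<bar>D n t\<bar>)"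
      by (simp add: set_integrable_def)
    have "AE t in lebesgue. t \<noteq> a \<and> t \<noteq> b"
      using AE_completion[OF AE_lborel_singleton[of a]] AE_completion[OF AE_lborel_singleton[of b]]
      by eventually_elim simp
    then show "AE t in lebesgue. \<bar>indicator {a..x} t *\<^sub>R D n t - indicator {a..z} t *\<^sub>R D n t\<bar>
        \<le> indicator {a<..<b} t *\<^sub>R \<bar>D n t\<bar>"
      by eventually_elim (use z 0 in \<open>auto simp: indicator_def\<close>)
  qed
  finally show ?case by (simp add: set_lebesgue_integral_def)
next
  case (Suc m)
  have int_nonneg: "0 \<le> (LINT t:{a<..<b}|lebesgue. \<bar>D n t\<bar>)"
    unfolding set_lebesgue_integral_def by (rule integral_nonneg_AE) auto
  let ?K = "(b - a) ^ m * (LINT t:{a<..<b}|lebesgue. \<bar>D n t\<bar>)"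
  obtain z where z: "z \<in> {a..b}" "D (n - 1 - Suc m) z = 0"
    using derivative_has_zero[OF D \<open>a < b\<close> \<open>k \<le> n\<close> za zb, of "n - 1 - Suc m"] Suc.prems by auto
  have suc: "Suc (n - 1 - Suc m) = n - 1 - m" using Suc.prems by simp
  have "norm (D (n - 1 - Suc m) x - D (n - 1 - Suc m) z) \<le> ?K * norm (x - z)"
  proof (rule field_differentiable_bound[of "{a..b}" _ "D (n - 1 - m)"])
    fix y assume y: "y \<in> {a..b}"
    have "Suc (n - 1 - Suc m) < n" using Suc.prems by simp
    then have "(D (n - 1 - Suc m) has_real_derivative D (Suc (n - 1 - Suc m)) y) (at y within {a..b})"
      using D y unfolding generalized_derivatives_def by blast
    then show "(D (n - 1 - Suc m) has_real_derivative D (n - 1 - m) y) (at y within {a..b})"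
      unfolding suc .
    show "norm (D (n - 1 - m) y) \<le> ?K" using Suc.IH[of y] y Suc.prems by simp
  qed (use z Suc.prems in auto)
  also have "\<dots> \<le> ?K * (b - a)"
    using z Suc.prems \<open>a < b\<close> int_nonneg by (intro mult_left_mono mult_nonneg_nonneg) auto
  finally show ?case using z by (simp add: algebra_simps)
qed

text \<open>Hoelder's inequality against the constant function \<open>1\<close>, proved by integrating Young's
  inequality after normalizing \<open>g\<close>.\<close>

lemma Hoelder_L1_Lq:
  assumes g: "set_integrable lebesgue {a<..<b} g" and "a < b" "1 < q" and fin: "lp_norm a b q g < \<infinity>"
  shows "ennreal (LINT t:{a<..<b}|lebesgue. \<bar>g t\<bar>)
    \<le> ennreal ((b - a) powr (1 - 1 / q)) * lp_norm a b q g"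
proof -
  let ?M = "lebesgue_on {a<..<b}"
  have gi: "integrable ?M g" using g by (subst (asm) set_integrable_eq) auto
  then have [measurable]: "g \<in> borel_measurable ?M" by simp
  have mu: "measure ?M (space ?M) = b - a"
    using \<open>a < b\<close> by (simp add: measure_restrict_space)
  interpret finite_measure ?M
    using \<open>a < b\<close> by (intro finite_measureI) (simp add: emeasure_restrict_space)
  have L: "(LINT t:{a<..<b}|lebesgue. \<bar>g t\<bar>) = (LINT t|?M. \<bar>g t\<bar>)"
    by (simp add: set_lebesgue_integral_def integral_restrict_space)
  have "(\<integral>\<^sup>+x. ennreal (\<bar>g x\<bar> powr q) \<partial>?M) < \<infinity>"
    using fin by (auto simp: lp_norm_def Let_def less_top split: if_splits)
  then have qi: "integrable ?M (\<lambda>x. \<bar>g x\<bar> powr q)"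
    by (intro integrableI_nonneg) auto
  define J where "J = (LINT t|?M. \<bar>g t\<bar> powr q)"
  have J: "(\<integral>\<^sup>+x. ennreal (\<bar>g x\<bar> powr q) \<partial>?M) = ennreal J"
    unfolding J_def by (rule nn_integral_eq_integral[OF qi]) auto
  have "J \<ge> 0" unfolding J_def by (rule integral_nonneg_AE) auto
  have norm: "lp_norm a b q g = ennreal (J powr (1 / q))"
    using J \<open>J \<ge> 0\<close> by (simp add: lp_norm_def Let_def)
  have "(LINT t|?M. \<bar>g t\<bar>) \<le> (b - a) powr (1 - 1 / q) * J powr (1 / q)"
  proof (cases "J = 0")
    case True
    then have "AE t in ?M. \<bar>g t\<bar> powr q = 0"
      using qi unfolding J_def by (subst (asm) integral_nonneg_eq_0_iff_AE) auto
    then have "AE t in ?M. \<bar>g t\<bar> = 0" by eventually_elim simp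
    then have "(LINT t|?M. \<bar>g t\<bar>) = 0" by (rule integral_eq_zero_AE)
    then show ?thesis by simp
  next
    case False
    with \<open>J \<ge> 0\<close> have "J > 0" by simp
    \<comment> \<open>The \<open>L\<^sub>q\<close> mean of \<open>g\<close>: with this scale the integral of \<open>(\<bar>g\<bar> / l) powr q\<close> is \<open>b - a\<close>, the
      same as that of \<open>1\<close>, so Young's inequality is integrated without loss.\<close>
    define l where "l = (J / (b - a)) powr (1 / q)"
    have "l > 0" using \<open>J > 0\<close> \<open>a < b\<close> by (simp add: l_def)
    have lq: "l powr q = J / (b - a)"
      using \<open>J > 0\<close> \<open>a < b\<close> \<open>1 < q\<close> by (simp add: l_def powr_powr)
    have young: "\<bar>g t\<bar> \<le> l * (1 - 1 / q) + l / (q * l powr q) * \<bar>g t\<bar> powr q" for t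
    proof (cases "g t = 0")
      case True
      then show ?thesis using \<open>l > 0\<close> \<open>1 < q\<close> by (simp add: field_simps)
    next
      case False
      have "((\<bar>g t\<bar> / l) powr q) powr (1 / q) * 1 powr (1 - 1 / q)
          \<le> 1 / q * (\<bar>g t\<bar> / l) powr q + (1 - 1 / q) * 1"
        using False \<open>l > 0\<close> \<open>1 < q\<close> by (intro Youngs_inequality_0) (auto simp: field_simps)
      then have "\<bar>g t\<bar> / l \<le> 1 / q * (\<bar>g t\<bar> powr q / l powr q) + (1 - 1 / q)"
        using False \<open>l > 0\<close> \<open>1 < q\<close> by (simp add: powr_powr powr_divide)
      then have "\<bar>g t\<bar> \<le> (1 / q * (\<bar>g t\<bar> powr q / l powr q) + (1 - 1 / q)) * l"
        using \<open>l > 0\<close> by (subst (asm) pos_divide_le_eq) 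
      then show ?thesis by (simp add: algebra_simps)
    qed
    have "(LINT t|?M. \<bar>g t\<bar>) \<le> (LINT t|?M. l * (1 - 1 / q) + l / (q * l powr q) * \<bar>g t\<bar> powr q)"
      using gi qi young by (intro integral_mono) auto
    also have "\<dots> = (b - a) * (l * (1 - 1 / q)) + l / (q * l powr q) * J"
      using qi mu by (simp add: J_def)
    also have "\<dots> = l * (b - a)"
      unfolding lq using \<open>J > 0\<close> \<open>a < b\<close> \<open>1 < q\<close> by (simp add: field_simps)
    also have "\<dots> = (b - a) powr (1 - 1 / q) * J powr (1 / q)"
      using \<open>J > 0\<close> \<open>a < b\<close> by (simp add: l_def powr_divide powr_diff)
    finally show ?thesis .
  qed
  then show ?thesis
    unfolding L norm using \<open>a < b\<close> by (simp flip: ennreal_mult)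
qed

lemma lp_norm_le_bound:
  assumes "\<And>x. x \<in> {a<..<b} \<Longrightarrow> \<bar>f x\<bar> \<le> K" "0 \<le> K" "a < b" "0 < p"
  shows "lp_norm a b p f \<le> ennreal (K * (b - a) powr (1 / p))"
proof -
  let ?I = "\<integral>\<^sup>+x. ennreal (\<bar>f x\<bar> powr p) \<partial>lebesgue_on {a<..<b}"
  have "?I \<le> (\<integral>\<^sup>+x. ennreal (K powr p) \<partial>lebesgue_on {a<..<b})"
    using assms by (intro nn_integral_mono ennreal_leI powr_mono2) auto
  also have "\<dots> = ennreal (K powr p * (b - a))"
    using \<open>a < b\<close> by (simp add: emeasure_restrict_space ennreal_mult)
  finally have le: "?I \<le> ennreal (K powr p * (b - a))" .
  then have "?I < \<infinity>" by (rule le_less_trans) simp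
  have "enn2real ?I \<le> K powr p * (b - a)"
    using le \<open>a < b\<close> by (intro enn2real_leI) auto
  then have "enn2real ?I powr (1 / p) \<le> (K powr p * (b - a)) powr (1 / p)"
    using assms by (intro powr_mono2) auto
  also have "\<dots> = K * (b - a) powr (1 / p)"
    using assms by (simp add: powr_mult powr_powr)
  finally show ?thesis
    using \<open>?I < \<infinity>\<close> by (auto simp: lp_norm_def Let_def intro: ennreal_leI)
qed

lemma lp_norm_indicator_interval:
  assumes "a < b"
  shows "lp_norm a b p (indicat_real {a<..<b}) = ennreal ((b - a) powr (1 / p))"
proof -
  have "(\<integral>\<^sup>+x. ennreal (\<bar>indicat_real {a<..<b} x\<bar> powr p) \<partial>lebesgue_on {a<..<b})
      = (\<integral>\<^sup>+x. 1 \<partial>lebesgue_on {a<..<b})"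
    by (rule nn_integral_cong) simp
  also have "\<dots> = ennreal (b - a)"
    using assms by (simp add: emeasure_restrict_space)
  finally show ?thesis using assms by (simp add: lp_norm_def)
qed

lemma lp_norm_eq_0_iff:
  assumes "g \<in> borel_measurable (lebesgue_on {a<..<b})"
  shows "lp_norm a b q g = 0 \<longleftrightarrow> ae_zero a b g"
proof -
  let ?I = "\<integral>\<^sup>+x. ennreal (\<bar>g x\<bar> powr q) \<partial>lebesgue_on {a<..<b}"
  have "?I = 0 \<longleftrightarrow> (AE x in lebesgue_on {a<..<b}. ennreal (\<bar>g x\<bar> powr q) = 0)"
    using assms by (intro nn_integral_0_iff_AE) measurable
  then have "?I = 0 \<longleftrightarrow> ae_zero a b g"
    by (simp add: ae_zero_def)
  then show ?thesis
    by (auto simp: lp_norm_def Let_def enn2real_eq_0_iff)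
qed

lemma Z_measurable:
  assumes "(f, g) \<in> Z n k a b" "n \<ge> 2"
  shows "f \<in> borel_measurable (lebesgue_on {a<..<b})"
    and "g \<in> borel_measurable (lebesgue_on {a<..<b})"
proof -
  obtain D where D: "generalized_derivatives a b n f D" "D n = g"
    using assms by (auto simp: Z_def)
  have "(f has_real_derivative D (Suc 0) x) (at x within {a..b})" if "x \<in> {a..b}" for x
  proof -
    have "Suc 0 < n" using \<open>n \<ge> 2\<close> by simp
    then show ?thesis using D(1) that unfolding generalized_derivatives_def by blast
  qed
  then have "continuous_on {a..b} f" by (rule DERIV_continuous_on)
  then have "continuous_on {a<..<b} f" by (rule continuous_on_subset) auto
  then show "f \<in> borel_measurable (lebesgue_on {a<..<b})"
    by (intro continuous_imp_measurable_on_sets_lebesgue) auto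
  have "set_integrable lebesgue {a..b} g"
    using D(1) unfolding generalized_derivatives_def D(2) by blast
  then have "set_integrable lebesgue {a<..<b} g"
    by (rule set_integrable_subset) auto
  then show "g \<in> borel_measurable (lebesgue_on {a<..<b})"
    by (subst (asm) set_integrable_eq) auto
qed

lemma Lp_Lq_estimate:
  assumes fg: "(f, g) \<in> Z n k a b" and "k \<le> n" "1 \<le> n" "a < b" "0 < p" "1 < q"
    and fin: "lp_norm a b q g < \<infinity>"
  shows "lp_norm a b p f \<le> ennreal ((b - a) powr (real n + 1 / p - 1 / q)) * lp_norm a b q g"
proof -
  obtain D where D: "generalized_derivatives a b n f D" "D n = g"
      "\<forall>i<k. D i a = 0" "\<forall>j<n - k. D j b = 0"
    using fg by (auto simp: Z_def)
  have D0: "D 0 = f" and gi: "set_integrable lebesgue {a..b} g"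
    using D(1) unfolding generalized_derivatives_def D(2) by blast+
  define L where "L = (LINT t:{a<..<b}|lebesgue. \<bar>g t\<bar>)"
  have "L \<ge> 0" 
    unfolding L_def set_lebesgue_integral_def by (rule integral_nonneg_AE) auto
  have "\<bar>f x\<bar> \<le> (b - a) ^ (n - 1) * L" if "x \<in> {a<..<b}" for x
    using derivative_bound[OF D(1) \<open>a < b\<close> \<open>k \<le> n\<close> D(3,4), of "n - 1" x] that \<open>1 \<le> n\<close> D(2) D0
    by (simp add: L_def)
  then have "lp_norm a b p f \<le> ennreal ((b - a) ^ (n - 1) * L * (b - a) powr (1 / p))"
    using \<open>a < b\<close> \<open>0 < p\<close> \<open>L \<ge> 0\<close> by (intro lp_norm_le_bound) auto
  also have "\<dots> = ennreal ((b - a) ^ (n - 1) * (b - a) powr (1 / p)) * ennreal L"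
    using \<open>a < b\<close> \<open>L \<ge> 0\<close> by (simp add: mult_ac flip: ennreal_mult)
  also have "\<dots> \<le> ennreal ((b - a) ^ (n - 1) * (b - a) powr (1 / p)) *
      (ennreal ((b - a) powr (1 - 1 / q)) * lp_norm a b q g)"
    unfolding L_def
    by (intro mult_left_mono Hoelder_L1_Lq set_integrable_subset[OF gi])
      (use \<open>a < b\<close> \<open>1 < q\<close> fin in auto)
  also have "\<dots> = ennreal ((b - a) ^ (n - 1) * (b - a) powr (1 / p) * (b - a) powr (1 - 1 / q)) *
      lp_norm a b q g"
    using \<open>a < b\<close> by (simp add: mult.assoc ennreal_mult)
  also have "(b - a) ^ (n - 1) * (b - a) powr (1 / p) * (b - a) powr (1 - 1 / q)
      = (b - a) powr (real n + 1 / p - 1 / q)"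
    using \<open>a < b\<close> \<open>1 \<le> n\<close> by (simp add: algebra_simps of_nat_diff flip: powr_realpow powr_add)
  finally show ?thesis .
qed

lemma A_const_le_1:
  assumes "n \<ge> 2" "k < n"
  shows "A_const n k \<le> 1"
  unfolding A_const_def
proof (rule Sup_least, safe)
  fix p q a b :: real and f g
  assume *: "1 < p" "1 < q" "a < b" "(f, g) \<in> Z n k a b" "lp_norm a b q g < \<infinity>" "\<not> ae_zero a b g"
  then have "lp_norm a b q g \<noteq> 0"
    using Z_measurable[OF *(4) \<open>n \<ge> 2\<close>] by (simp add: lp_norm_eq_0_iff)
  then show "lp_norm a b p f / (ennreal ((b - a) powr (real n + 1 / p - 1 / q)) * lp_norm a b q g) \<le> 1"
    using * assms Lp_Lq_estimate[OF *(4), of p q]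
    by (intro divide_le_posI_ennreal) (auto simp: ennreal_zero_less_mult_iff zero_less_iff_neq_zero)
qed

text \<open>The inequality that defines \<open>A(n,k)\<close>, multiplied out; this is legitimate because the
  denominator is neither \<open>0\<close> nor \<open>\<infinity>\<close>.\<close>

lemma lp_norm_le_A_const:
  assumes fg: "(f, g) \<in> Z n k a b" "\<not> ae_zero a b g" and "n \<ge> 2" "a < b" "1 < p" "1 < q"
    and fin: "lp_norm a b q g < \<infinity>"
  shows "lp_norm a b p f \<le>
    A_const n k * (ennreal ((b - a) powr (real n + 1 / p - 1 / q)) * lp_norm a b q g)"
proof -
  define d where "d = ennreal ((b - a) powr (real n + 1 / p - 1 / q)) * lp_norm a b q g"
  have "lp_norm a b q g \<noteq> 0"
    using fg Z_measurable[OF fg(1) \<open>n \<ge> 2\<close>] by (simp add: lp_norm_eq_0_iff)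
  then have d: "d \<noteq> 0" "d < \<infinity>"
    using fin \<open>a < b\<close> by (auto simp: d_def ennreal_mult_less_top)
  have "lp_norm a b p f / d \<le> A_const n k"
    unfolding A_const_def d_def by (rule Sup_upper) (use assms in blast)
  then have "lp_norm a b p f / d * d \<le> A_const n k * d" by (rule mult_right_mono) simp
  moreover have "lp_norm a b p f / d * d = lp_norm a b p f"
    using d by (simp add: ennreal_divide_times)
  ultimately show ?thesis by (simp add: d_def)
qed

section \<open>Auxiliary norms and fundamental functions\<close>

text \<open>What an m.r.i. space knows about its auxiliary norm independently of the underlying interval
  \<open>(a,b)\<close>; this part is shared by the spaces over intervals of all lengths.\<close>

locale auxiliary_norm = ri_norm "lebesgue_on {p. A < p \<and> ereal p < B}" N
  for A :: real and B :: ereal and N :: "(real \<Rightarrow> ennreal) \<Rightarrow> ennreal" +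
  assumes bounds: "1 \<le> A" "ereal A < B"
begin

abbreviation "I \<equiv> lebesgue_on {p. A < p \<and> ereal p < B}"

lemma space_gt_1: "p \<in> space I \<Longrightarrow> 1 < p"
  using bounds by simp

lemma lp_norm_measurable [measurable]:
  assumes "f \<in> borel_measurable (lebesgue_on {a<..<b})"
  shows "(\<lambda>p. lp_norm a b p f) \<in> borel_measurable I"
proof -
  have "(\<lambda>p. lp_norm a b p f) \<in> borel_measurable lebesgue"
    using borel_measurable_lp_norm[OF assms] by (intro measurable_completion) simp
  then show ?thesis by (rule measurable_restrict_space1)
qed

lemma powr_measurable [measurable]: "(\<lambda>p. ennreal (d powr (1 / p))) \<in> borel_measurable I"
  by (intro measurable_restrict_space1 measurable_completion) measurable

lemma not_AE_False: "\<not> (AE p in I. False)"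
proof
  assume AE: "AE p in I. False"
  let ?S = "{p. A < p \<and> ereal p < B}"
  have S: "?S = {A<..} \<inter> ereal -` {..<B}" by auto
  have op: "open ?S" unfolding S by (intro open_Int open_greaterThan open_vimage) (auto intro: continuous_on_ereal)
  obtain p where "ereal A < ereal p" "ereal p < B"
    using bounds(2) ereal_dense2 by blast
  then have ne: "?S \<noteq> {}" by auto
  have "AE p in lebesgue. p \<notin> ?S"
    using AE op by (subst (asm) AE_restrict_space_iff) auto
  then have "negligible ?S"
    using op by (simp add: negligible_iff_null_sets AE_iff_null_sets)
  then show False using open_not_negligible[OF op ne] by simp
qed

lemma norm_pos:
  assumes "h \<in> borel_measurable I" "\<And>p. p \<in> space I \<Longrightarrow> h p \<noteq> 0"
  shows "N h \<noteq> 0"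
proof
  assume "N h = 0"
  then have "AE p in I. h p = 0" using eq_0_iff assms(1) by blast
  then have "AE p in I. False" using AE_space by eventually_elim (use assms(2) in auto)
  then show False using not_AE_False by blast
qed

text \<open>The function \<open>e\<close> equal to \<open>\<infinity>\<close> where \<open>h\<close> is and to \<open>0\<close> elsewhere satisfies \<open>2 * e = e\<close>, so its norm
  is \<open>0\<close> or \<open>\<infinity>\<close>, and it is not \<open>0\<close>.\<close>

lemma norm_eq_top:
  assumes h: "h \<in> borel_measurable I" and "\<not> (AE p in I. h p < \<infinity>)"
  shows "N h = \<infinity>"
proof -
  define e :: "real \<Rightarrow> ennreal" where "e p = (if h p = \<infinity> then \<infinity> else 0)" for p
  have e[measurable]: "e \<in> borel_measurable I" unfolding e_def using h by measurable
  have "N e \<noteq> 0"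
  proof
    assume "N e = 0"
    then have "AE p in I. e p = 0" using eq_0_iff e by blast
    then have "AE p in I. h p < \<infinity>"
      by eventually_elim (auto simp: e_def less_top split: if_splits)
    then show False using assms(2) by blast
  qed
  moreover have "(\<lambda>p. ennreal 2 * e p) = e"
    by (auto simp: e_def fun_eq_iff ennreal_mult_top)
  then have "N e = N e + N e" using scale[OF e, of 2] by (simp add: mult_2)
  then have "N e = 0 \<or> N e = \<infinity>"
    by (cases "N e") (auto simp flip: ennreal_plus)
  moreover have "N e \<le> N h" using h e by (intro mono) (auto simp: e_def)
  ultimately show ?thesis by (simp add: top_unique)
qed

text \<open>By monotonicity the supremum is attained at the whole interval, whose indicator has moments
  \<open>(b - a) powr (1 / p)\<close>.\<close>

lemma fundamental_function_eq:
  assumes "a < b"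
  shows "fundamental_function (mri_norm N) a b (b - a) = N (\<lambda>p. ennreal ((b - a) powr (1 / p)))"
proof -
  have top: "mri_norm N a b (indicat_real {a<..<b}) = N (\<lambda>p. ennreal ((b - a) powr (1 / p)))"
    using assms by (simp add: mri_norm_def lp_norm_indicator_interval)
  have meas: "indicat_real E \<in> borel_measurable (lebesgue_on {a<..<b})" if "E \<in> sets lebesgue" for E
    using that by (intro measurable_restrict_space1 borel_measurable_indicator)
  have le: "mri_norm N a b (indicat_real E) \<le> mri_norm N a b (indicat_real {a<..<b})"
    if "E \<in> sets lebesgue" "E \<subseteq> {a<..<b}" for E
    unfolding mri_norm_def
  proof (rule mono)
    show "AE p in I. lp_norm a b p (indicat_real E) \<le> lp_norm a b p (indicat_real {a<..<b})"
    proof (rule AE_I2)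
      fix p assume "p \<in> space I"
      then show "lp_norm a b p (indicat_real E) \<le> lp_norm a b p (indicat_real {a<..<b})"
        using space_gt_1[of p] that by (intro lp_norm_mono) (auto simp: indicator_def)
    qed
  qed (use that in \<open>auto intro!: lp_norm_measurable meas\<close>)
  have "fundamental_function (mri_norm N) a b (b - a) = mri_norm N a b (indicat_real {a<..<b})"
    unfolding fundamental_function_def
    using assms by (intro antisym SUP_least SUP_upper le) auto
  then show ?thesis using top by simp
qed

text \<open>Finiteness of the fundamental function does not depend on the length: changing \<open>d\<close> to \<open>e\<close>
  multiplies \<open>d powr (1 / p)\<close> by \<open>(e / d) powr (1 / p)\<close>, which is at most \<open>max 1 (e / d)\<close> since
  \<open>p > 1\<close>.\<close>

lemma power_norm_finite_rescale:
  assumes "0 < d" "0 < e" and fin: "N (\<lambda>p. ennreal (d powr (1 / p))) < \<infinity>"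
  shows "N (\<lambda>p. ennreal (e powr (1 / p))) < \<infinity>"
proof -
  define C where "C = max 1 (e / d)"
  have "N (\<lambda>p. ennreal (e powr (1 / p))) \<le> N (\<lambda>p. ennreal C * ennreal (d powr (1 / p)))"
  proof (rule mono)
    show "AE p in I. ennreal (e powr (1 / p)) \<le> ennreal C * ennreal (d powr (1 / p))"
    proof (rule AE_I2)
      fix p assume "p \<in> space I"
      then have p: "1 < p" by (rule space_gt_1)
      have "e powr (1 / p) \<le> (C * d) powr (1 / p)"
        using assms p by (intro powr_mono2) (auto simp: C_def max_def field_simps)
      also have "\<dots> = C powr (1 / p) * d powr (1 / p)"
        using assms by (simp add: powr_mult C_def)
      also have "\<dots> \<le> C powr 1 * d powr (1 / p)"
        using p by (intro mult_right_mono powr_mono) (auto simp: C_def)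
      finally show "ennreal (e powr (1 / p)) \<le> ennreal C * ennreal (d powr (1 / p))"
        by (auto simp: C_def simp flip: ennreal_mult intro!: ennreal_leI)
    qed
  qed measurable
  also have "\<dots> = ennreal C * N (\<lambda>p. ennreal (d powr (1 / p)))"
    by (rule scale[OF powr_measurable]) (simp add: C_def)
  also have "\<dots> < \<infinity>" using fin by (simp add: ennreal_mult_less_top)
  finally show ?thesis .
qed

end

lemma mri_space_auxiliary_norm: "mri_space a b \<rho> A B N \<Longrightarrow> auxiliary_norm A B N"
  by (simp add: mri_space_def mri_space_axioms_def auxiliary_norm_def auxiliary_norm_axioms_def)

text \<open>This is the norm of the indicator of the whole interval; such norms are finite in an
  r.i. space over a set of finite measure.\<close>

lemma (in mri_space) power_norm_finite:
  assumes "a < b"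
  shows "N (\<lambda>p. ennreal ((b - a) powr (1 / p))) < \<infinity>"
proof -
  have S: "{a<..<b} \<in> sets (lebesgue_on {a<..<b})"
    by (simp add: sets_restrict_space_iff)
  then have ind: "indicat_real {a<..<b} \<in> borel_measurable (lebesgue_on {a<..<b})"
    by (rule borel_measurable_indicator)
  have "\<rho> (indicator {a<..<b}) < \<infinity>"
    using S assms by (intro indicator_finite) (simp_all add: emeasure_restrict_space)
  moreover have "(\<lambda>x. ennreal \<bar>indicat_real {a<..<b} x\<bar>) = indicator {a<..<b}"
    by (auto simp: indicator_def)
  ultimately have "mri_norm N a b (indicat_real {a<..<b}) < \<infinity>"
    using norm_eq_mri_norm[OF ind] by simp
  then show ?thesis
    using assms by (simp add: mri_norm_def lp_norm_indicator_interval)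
qed

section \<open>The Wirtinger inequality\<close>

text \<open>The inequality between moments is averaged twice: \<open>N\<close> is applied in \<open>p\<close> for
  fixed \<open>q\<close> (\<open>step\<close>), and \<open>N'\<close> is applied in \<open>q\<close> to the result (\<open>main\<close>). The finiteness assumptions
  say that both fundamental functions are finite at \<open>b - a\<close>.\<close>

lemma wirtinger_quotient_le_A_const:
  assumes X: "auxiliary_norm A B N" and Y: "auxiliary_norm A' B' N'" and "a < b"
    and finX: "N (\<lambda>p. ennreal ((b - a) powr (1 / p))) < \<infinity>"
    and finY: "N' (\<lambda>p. ennreal ((b - a) powr (1 / p))) < \<infinity>"
    and fg: "(f, g) \<in> Z n k a b" "\<not> ae_zero a b g" and "n \<ge> 2" "k < n"
  shows "(mri_norm N a b f / fundamental_function (mri_norm N) a b (b - a)) /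
      (ennreal ((b - a) ^ n) * mri_norm N' a b g / fundamental_function (mri_norm N') a b (b - a))
    \<le> A_const n k"
proof -
  interpret X: auxiliary_norm A B N by fact
  interpret Y: auxiliary_norm A' B' N' by fact
  define \<Delta> where "\<Delta> = b - a"
  have "\<Delta> > 0" using \<open>a < b\<close> by (simp add: \<Delta>_def)
  define F where "F p = lp_norm a b p f" for p
  define G where "G q = lp_norm a b q g" for q
  define \<phi> where "\<phi> = N (\<lambda>p. ennreal (\<Delta> powr (1 / p)))"
  define \<psi> where "\<psi> = N' (\<lambda>p. ennreal (\<Delta> powr (1 / p)))"
  note meas = Z_measurable[OF fg(1) \<open>n \<ge> 2\<close>]
  have F: "F \<in> borel_measurable X.I" unfolding F_def by (rule X.lp_norm_measurable[OF meas(1)])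
  have G: "G \<in> borel_measurable Y.I" unfolding G_def by (rule Y.lp_norm_measurable[OF meas(2)])
  have G0: "G q \<noteq> 0" for q using lp_norm_eq_0_iff[OF meas(2)] fg(2) by (simp add: G_def)
  have \<phi>: "\<phi> \<noteq> 0" "\<phi> < \<infinity>"
    using X.norm_pos[OF X.powr_measurable, of \<Delta>] finX \<open>\<Delta> > 0\<close> by (auto simp: \<phi>_def \<Delta>_def)
  have \<psi>: "\<psi> \<noteq> 0" "\<psi> < \<infinity>"
    using Y.norm_pos[OF Y.powr_measurable, of \<Delta>] finY \<open>\<Delta> > 0\<close> by (auto simp: \<psi>_def \<Delta>_def)
  define v where "v = ennreal (\<Delta> ^ n) * N' G / \<psi>"
  have "N F / \<phi> / v \<le> A_const n k"
  proof (cases "N' G = \<infinity>")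
    case True
    then have "v = \<infinity>"
      using \<open>\<Delta> > 0\<close> \<psi> by (simp add: v_def ennreal_mult_top ennreal_top_divide)
    then show ?thesis by simp
  next
    case False
    have "N' G \<noteq> 0" using G G0 by (rule Y.norm_pos)
    have AEfin: "AE q in Y.I. G q < \<infinity>" using Y.norm_eq_top[OF G] False by blast
    have "A_const n k < \<infinity>"
      using A_const_le_1[OF \<open>n \<ge> 2\<close> \<open>k < n\<close>] by (rule le_less_trans) simp
    then obtain c where c: "A_const n k = ennreal c" "0 \<le> c"
      by (cases "A_const n k") auto
    have step: "N F / \<phi> \<le> ennreal (c * \<Delta> powr (real n - 1 / q)) * G q"
      if q: "1 < q" "G q < \<infinity>" for q
    proof -
      obtain r where r: "G q = ennreal r" "0 \<le> r" using q(2) by (cases "G q") auto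
      define s where "s = c * \<Delta> powr (real n - 1 / q) * r"
      have "s \<ge> 0" using c r by (simp add: s_def)
      have "N F \<le> N (\<lambda>p. ennreal s * ennreal (\<Delta> powr (1 / p)))"
      proof (rule X.mono)
        show "AE p in X.I. F p \<le> ennreal s * ennreal (\<Delta> powr (1 / p))"
        proof (rule AE_I2)
          fix p assume "p \<in> space X.I"
          then have "1 < p" by (rule X.space_gt_1)
          have "F p \<le> ennreal c * (ennreal (\<Delta> powr (real n + 1 / p - 1 / q)) * ennreal r)"
            using lp_norm_le_A_const[OF fg \<open>n \<ge> 2\<close> \<open>a < b\<close> \<open>1 < p\<close> q(1)] q(2)
            by (simp add: F_def G_def[symmetric] r(1) c \<Delta>_def)
          also have "\<Delta> powr (real n + 1 / p - 1 / q)
              = \<Delta> powr (real n - 1 / q) * \<Delta> powr (1 / p)"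
            by (simp add: algebra_simps flip: powr_add)
          finally show "F p \<le> ennreal s * ennreal (\<Delta> powr (1 / p))"
            using c r by (simp add: s_def mult_ac flip: ennreal_mult)
        qed
      qed (use F in measurable)
      also have "\<dots> = \<phi> * ennreal s"
        unfolding \<phi>_def using X.scale[OF X.powr_measurable \<open>s \<ge> 0\<close>, of \<Delta>]
        by (simp add: mult.commute)
      finally have "N F / \<phi> \<le> ennreal s"
        using \<phi> by (intro divide_le_posI_ennreal) (auto simp: zero_less_iff_neq_zero)
      then show ?thesis using c r by (simp add: s_def ennreal_mult)
    qed
    \<comment> \<open>A single exponent \<open>q\<close> with \<open>\<bar>g\<bar>\<^sub>q < \<infinity>\<close> makes the normalized \<open>X\<close>-norm of \<open>f\<close> a real number
      \<open>u\<close>, which can then be taken out of \<open>N'\<close>.\<close>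
    obtain q where "q \<in> space Y.I" "G q < \<infinity>"
    proof (rule ccontr)
      assume "\<not> thesis"
      then have no: "\<not> (G q < \<infinity> \<and> q \<in> space Y.I)" for q using that by blast
      have "AE q in Y.I. False"
        by (rule eventually_mono[OF eventually_conj[OF AEfin AE_space]]) (use no in blast)
      then show False using Y.not_AE_False by blast
    qed
    then have "N F / \<phi> < \<infinity>"
      using Y.space_gt_1 by (intro le_less_trans[OF step[of q]]) (auto simp: ennreal_mult_less_top)
    then obtain u where u: "N F / \<phi> = ennreal u" "0 \<le> u" by (cases "N F / \<phi>") auto
    have "ennreal u * \<psi> = N' (\<lambda>q. ennreal u * ennreal (\<Delta> powr (1 / q)))"
      unfolding \<psi>_def by (rule Y.scale[OF Y.powr_measurable u(2), symmetric])
    also have "\<dots> \<le> N' (\<lambda>q. ennreal (c * \<Delta> ^ n) * G q)"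
    proof (rule Y.mono)
      show "AE q in Y.I. ennreal u * ennreal (\<Delta> powr (1 / q)) \<le> ennreal (c * \<Delta> ^ n) * G q"
        using AEfin AE_space
      proof eventually_elim
        case (elim q)
        then have "ennreal u * ennreal (\<Delta> powr (1 / q))
            \<le> ennreal (c * \<Delta> powr (real n - 1 / q)) * G q * ennreal (\<Delta> powr (1 / q))"
          using step[of q] Y.space_gt_1[of q] u by (intro mult_right_mono) auto
        also have "\<dots> = ennreal (c * (\<Delta> powr (real n - 1 / q) * \<Delta> powr (1 / q))) * G q"
          using c by (simp add: ennreal_mult mult_ac)
        also have "\<Delta> powr (real n - 1 / q) * \<Delta> powr (1 / q) = \<Delta> ^ n"
          using \<open>\<Delta> > 0\<close> by (simp add: powr_realpow flip: powr_add)
        finally show ?case .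
      qed
    qed (use G in measurable)
    also have "\<dots> = ennreal (c * \<Delta> ^ n) * N' G"
      using G c \<open>\<Delta> > 0\<close> by (intro Y.scale) auto
    finally have main: "ennreal u * \<psi> \<le> ennreal (c * \<Delta> ^ n) * N' G" .
    have "ennreal u = ennreal u * \<psi> / \<psi>"
      using \<psi> by (simp add: ennreal_mult_divide_eq)
    also have "\<dots> \<le> ennreal (c * \<Delta> ^ n) * N' G / \<psi>"
      using main by (rule divide_right_mono_ennreal)
    also have "\<dots> = v * ennreal c"
      using c \<open>\<Delta> > 0\<close> by (simp add: v_def ennreal_mult divide_ennreal_def mult_ac)
    finally have "ennreal u \<le> v * ennreal c" .
    moreover have "v \<noteq> 0"
      using \<open>\<Delta> > 0\<close> \<open>N' G \<noteq> 0\<close> \<psi>(2) by (auto simp: v_def)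
    then have "v > 0" by (simp only: zero_less_iff_neq_zero not_False_eq_True)
    ultimately show ?thesis
      unfolding u(1) c(1) by (intro divide_le_posI_ennreal)
  qed
  then show ?thesis
    unfolding X.fundamental_function_eq[OF \<open>a < b\<close>] Y.fundamental_function_eq[OF \<open>a < b\<close>]
    by (simp add: v_def \<phi>_def \<psi>_def mri_norm_def F_def[abs_def] G_def[abs_def] \<Delta>_def)
qed

theorem theorem3p1:
  fixes n k :: nat and a b :: real
    and X Y :: "(real \<Rightarrow> ennreal) \<Rightarrow> ennreal"
    and A A' :: real and B B' :: ereal
    and N N' :: "(real \<Rightarrow> ennreal) \<Rightarrow> ennreal"
  assumes "n \<ge> 2" and "k < n" and "a < b"
    and "mri_space a b X A B N"
    and "mri_space a b Y A' B' N'"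
  shows "wirtinger_pair n k (mri_norm N) (mri_norm N') \<and>
    (SUP \<Delta>\<in>{0<..}. wirtinger_functional n k (mri_norm N) (mri_norm N') \<Delta>) \<le> A_const n k \<and>
    A_const n k < \<infinity>"
proof -
  have aux: "auxiliary_norm A B N" "auxiliary_norm A' B' N'"
    using assms by (auto intro: mri_space_auxiliary_norm)
  have fin: "N (\<lambda>p. ennreal (\<Delta> powr (1 / p))) < \<infinity>" "N' (\<lambda>p. ennreal (\<Delta> powr (1 / p))) < \<infinity>"
    if "0 < \<Delta>" for \<Delta>
  proof -
    have "0 < b - a" using \<open>a < b\<close> by simp
    show "N (\<lambda>p. ennreal (\<Delta> powr (1 / p))) < \<infinity>"
      using auxiliary_norm.power_norm_finite_rescale[OF aux(1) \<open>0 < b - a\<close> that]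
        mri_space.power_norm_finite[OF assms(4) \<open>a < b\<close>] .
    show "N' (\<lambda>p. ennreal (\<Delta> powr (1 / p))) < \<infinity>"
      using auxiliary_norm.power_norm_finite_rescale[OF aux(2) \<open>0 < b - a\<close> that]
        mri_space.power_norm_finite[OF assms(5) \<open>a < b\<close>] .
  qed
  have le: "(SUP \<Delta>\<in>{0<..}. wirtinger_functional n k (mri_norm N) (mri_norm N') \<Delta>) \<le> A_const n k"
  proof (rule SUP_least)
    fix \<Delta> :: real assume "\<Delta> \<in> {0<..}"
    then show "wirtinger_functional n k (mri_norm N) (mri_norm N') \<Delta> \<le> A_const n k"
      unfolding wirtinger_functional_def
      using fin[of \<Delta>] assms(1,2)
      by (intro Sup_least) (auto intro!: wirtinger_quotient_le_A_const[OF aux])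
  qed
  have "A_const n k < \<infinity>"
    using A_const_le_1[OF \<open>n \<ge> 2\<close> \<open>k < n\<close>] by (rule le_less_trans) simp
  with le show ?thesis
    unfolding wirtinger_pair_def using le_less_trans by blast
qed

end
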